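(* Let $\Lambda$ be a real diagonal $n\times n$ matrix with $\Lambda_i+\Lambda_j>0$ for all $i\ne j$. Consider sequences $(f_{k\,k-1})_{k\ge1}$ in $\operatorname{SO}(n)$ and $(\Pi_k)_{k\ge0}$ in $\mathfrak{so}(n)^*\cong\mathfrak{so}(n)$ governed by the DEP algorithm $$f_{k+1\,k}^T\Lambda-\Lambda f_{k+1\,k}=\Lambda f_{k\,k-1}^T-f_{k\,k-1}\Lambda\qquad(k\ge1)$$ and the DLP algorithm $$\Pi_{k+1}=f_{k+1\,k}\,\Pi_k\,f_{k+1\,k}^T\qquad(k\ge0),$$ where the initial momentum is $\Pi_0=f_{1\,0}^T\Lambda-\Lambda f_{1\,0}$. These algorithms are equivalent to the Moser-Veselov equations $$\begin{cases}M_{k+1}=\omega_kM_k\omega_k^{-1},\\ M_k=\omega_k^T\Lambda-\Lambda\omega_k,\quad\omega_k\in\operatorname{SO}(n),\end{cases}\qquad(k\ge1),$$ under the identifications $f_{k\,k-1}=\omega_k$ and $\Pi_{k-1}=M_k$. That is, under these identifications, $(\omega_k,M_k)_{k\ge1}$ satisfies the Moser-Veselov equations if and only if $(f_{k\,k-1})_{k\ge 1}$, $(\Pi_k)_{k\ge 0}$ satisfy the DEP and DLP algorithms with the stated initial momentum.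
   Context: Given a trajectory $(g_k)_{k\ge0}$ in $\operatorname{SO}(n)$, the reduced variable of the left-invariant discrete system is $f_{k+1\,k}=g_{k+1}^{-1}g_k$, and in the Moser-Veselov notation $\omega_k=g_k^Tg_{k-1}\in\operatorname{SO}(n)$ is the discrete angular velocity, $M_k=g_{k-1}^Tm_kg_{k-1}=\omega_k^T\Lambda-\Lambda\omega_k\in\mathfrak{so}(n)$ is the discrete body angular momentum, and $m_k=m_0$ is the constant discrete spatial angular momentum. The DLP variable is $\Pi_k=\operatorname{Ad}^*_{g_k}\pi_0=g_k^T\pi_0g_k$ with constant spatial momentum $\pi_0$, and $\pi_0$ is identified with $m_0$. The algebra $\mathfrak{so}(n)$ is the space of skew-symmetric real $n\times n$ matrices. *)

theory Defs
  imports "HOL-Analysis.Analysis"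
begin

(* The sequence (f_{k k-1})_{k >= 1} is encoded as f :: nat => matrix, where f k stands
   for f_{k k-1}; hence f (k + 1) is f_{k+1 k}, and the value f 0 is never used. In the same
   way, only omega k and M k with k >= 1 are used. *)

definition SO :: "(real^'n^'n) set" where
  "SO = {A. rotation_matrix A}"

definition so :: "(real^'n^'n) set" where
  "so = {A. transpose A = - A}"

definition diagonal :: "real^'n^'n \<Rightarrow> bool" where
  "diagonal L \<longleftrightarrow> (\<forall>i j. i \<noteq> j \<longrightarrow> L $ i $ j = 0)"

definition DEP :: "real^'n^'n \<Rightarrow> (nat \<Rightarrow> real^'n^'n) \<Rightarrow> bool" where
  "DEP L f \<longleftrightarrow>
     (\<forall>k\<ge>1. f k \<in> SO) \<and>
     (\<forall>k\<ge>1. transpose (f (k + 1)) ** L - L ** f (k + 1) = L ** transpose (f k) - f k ** L)"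

(* P is the sequence Pi_k; its values, which lie in so(n)^*, are taken in so(n) under the
   identification of the two. *)
definition DLP :: "(nat \<Rightarrow> real^'n^'n) \<Rightarrow> (nat \<Rightarrow> real^'n^'n) \<Rightarrow> bool" where
  "DLP f P \<longleftrightarrow>
     (\<forall>k. P k \<in> so) \<and>
     (\<forall>k. P (k + 1) = f (k + 1) ** P k ** transpose (f (k + 1)))"

(* Since L is diagonal, the second equation forces M k to be skew-symmetric for k >= 1. *)
definition moser_veselov ::
    "real^'n^'n \<Rightarrow> (nat \<Rightarrow> real^'n^'n) \<Rightarrow> (nat \<Rightarrow> real^'n^'n) \<Rightarrow> bool" where
  "moser_veselov L \<omega> M \<longleftrightarrow>
     (\<forall>k\<ge>1. M (k + 1) = \<omega> k ** M k ** matrix_inv (\<omega> k)) \<and>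
     (\<forall>k\<ge>1. M k = transpose (\<omega> k) ** L - L ** \<omega> k \<and> \<omega> k \<in> SO)"

end

theory Submission
  imports Defs
begin

text \<open>
  The body momentum of an angular velocity \<open>w\<close> is \<open>w\<^sup>T L - L w\<close>.  For orthogonal \<open>w\<close>,
  conjugating it by \<open>w\<close> cancels one factor in each of its two terms and gives
  \<open>L w\<^sup>T - w L\<close> (\<open>conjugate_body_momentum\<close>), the right-hand side of the DEP equation.
  So, as soon as the momenta have the form \<open>M\<^sub>k = \<omega>\<^sub>k\<^sup>T L - L \<omega>\<^sub>k\<close>, the DEP equation at \<open>k\<close>
  and the transport law \<open>M\<^sub>k\<^sub>+\<^sub>1 = \<omega>\<^sub>k M\<^sub>k \<omega>\<^sub>k\<^sup>T\<close> are the same equation.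

  The Moser-Veselov equations impose that form at every step, whereas DEP and DLP impose it only on
  the initial momentum; induction along DLP propagates it, because the transported
  momentum \<open>L \<omega>\<^sub>k\<^sup>T - \<omega>\<^sub>k L\<close> is by DEP again the body momentum of \<open>\<omega>\<^sub>k\<^sub>+\<^sub>1\<close>.  The transport
  law itself is DLP, since the inverse of a rotation is its transpose.
\<close>

lemma SO_inverse:
  assumes "A \<in> SO"
  shows "A ** transpose A = mat 1" "matrix_inv A = transpose A"
proof -
  have o: "transpose A ** A = mat 1" "A ** transpose A = mat 1"
    using assms by (auto simp: SO_def rotation_matrix_def orthogonal_matrix_def)
  then show "A ** transpose A = mat 1" by simp
  show "matrix_inv A = transpose A"
  proof -
    have "A ** matrix_inv A = mat 1"
      using someI_ex[of "\<lambda>B. A ** B = mat 1 \<and> B ** A = mat 1"] o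
      unfolding matrix_inv_def by blast
    then show ?thesis
      by (metis o(1) matrix_mul_assoc matrix_mul_lid matrix_mul_rid)
  qed
qed

lemma diagonal_imp_symmetric:
  assumes "diagonal L"
  shows "transpose L = L"
  using assms unfolding diagonal_def transpose_def vec_eq_iff
  by (metis vec_lambda_beta)

text \<open>
  The membership \<open>\<Pi>\<^sub>k \<in> so(n)\<close> is part of DLP; on the Moser-Veselov side it comes from the
  form of \<open>M\<^sub>k\<close>: transposition exchanges the two terms when \<open>L\<close> is symmetric.
\<close>

lemma body_momentum_in_so:
  fixes L w :: "real^'n^'n"
  assumes "transpose L = L"
  shows "transpose w ** L - L ** w \<in> so"
proof -
  have minus: "transpose (A - B) = transpose A - transpose B" for A B :: "real^'n^'n"
    by (simp add: transpose_def vec_eq_iff)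
  show ?thesis
    by (simp add: so_def minus matrix_transpose_mul assms)
qed

lemma matrix_mult_diff_distrib:
  fixes A B C :: "'a::ring_1^'n^'n"
  shows "A ** (B - C) = A ** B - A ** C" "(B - C) ** A = B ** A - C ** A"
  by (simp_all add: matrix_matrix_mult_def vec_eq_iff sum_subtractf algebra_simps)

lemma conjugate_body_momentum:
  fixes L w :: "real^'n^'n"
  assumes "w \<in> SO"
  shows "w ** (transpose w ** L - L ** w) ** transpose w = L ** transpose w - w ** L"
proof -
  have "w ** (transpose w ** L - L ** w) ** transpose w
      = (w ** transpose w) ** L ** transpose w - w ** L ** (w ** transpose w)"
    by (simp add: matrix_mult_diff_distrib matrix_mul_assoc)
  then show ?thesis
    using SO_inverse(1)[OF assms] by simp
qed

theorem theorem5p1: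
  fixes \<Lambda> :: "real^'n^'n"
    and f P \<omega> M :: "nat \<Rightarrow> real^'n^'n"
  assumes "diagonal \<Lambda>"
    and "\<forall>i j. i \<noteq> j \<longrightarrow> \<Lambda> $ i $ i + \<Lambda> $ j $ j > 0"
    and "\<forall>k\<ge>1. f k = \<omega> k"
    and "\<forall>k\<ge>1. P (k - 1) = M k"
  shows "moser_veselov \<Lambda> \<omega> M \<longleftrightarrow>
    DEP \<Lambda> f \<and> DLP f P \<and> P 0 = transpose (f 1) ** \<Lambda> - \<Lambda> ** f 1"
proof
  have f: "f k = \<omega> k" if "k \<ge> 1" for k
    using assms(3) that by simp
  have P: "P k = M (k + 1)" for k
    using assms(4)[rule_format, of "k + 1"] by simp
  {
    assume mv: "moser_veselov \<Lambda> \<omega> M"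
    have SO: "\<omega> k \<in> SO" and M: "M k = transpose (\<omega> k) ** \<Lambda> - \<Lambda> ** \<omega> k"
      and step: "M (k + 1) = \<omega> k ** M k ** transpose (\<omega> k)" if "k \<ge> 1" for k
      using mv that by (auto simp: moser_veselov_def SO_inverse(2))
    have "transpose (\<omega> (k + 1)) ** \<Lambda> - \<Lambda> ** \<omega> (k + 1) = \<Lambda> ** transpose (\<omega> k) - \<omega> k ** \<Lambda>"
      if "k \<ge> 1" for k
      using M[of "k + 1"] step[OF that] M[OF that] conjugate_body_momentum[OF SO[OF that]]
      by simp
    then have "DEP \<Lambda> f"
      using SO by (simp add: DEP_def f)
    moreover have "DLP f P"
      unfolding DLP_def
    proof (intro conjI allI)
      fix k
      show "P k \<in> so"
        using body_momentum_in_so[OF diagonal_imp_symmetric[OF assms(1)]] M[of "k + 1"]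
        by (simp add: P)
      show "P (k + 1) = f (k + 1) ** P k ** transpose (f (k + 1))"
        using step[of "k + 1"] by (simp add: P f)
    qed
    moreover have "P 0 = transpose (f 1) ** \<Lambda> - \<Lambda> ** f 1"
      using M[of 1] by (simp add: P f)
    ultimately show "DEP \<Lambda> f \<and> DLP f P \<and> P 0 = transpose (f 1) ** \<Lambda> - \<Lambda> ** f 1"
      by blast
  }
  {
    assume R: "DEP \<Lambda> f \<and> DLP f P \<and> P 0 = transpose (f 1) ** \<Lambda> - \<Lambda> ** f 1"
    have SO: "\<omega> k \<in> SO"
      and dep: "transpose (\<omega> (k + 1)) ** \<Lambda> - \<Lambda> ** \<omega> (k + 1) = \<Lambda> ** transpose (\<omega> k) - \<omega> k ** \<Lambda>"
      if "k \<ge> 1" for k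
      using R that by (auto simp: DEP_def f)
    have step: "M (k + 1) = \<omega> k ** M k ** transpose (\<omega> k)" if "k \<ge> 1" for k
    proof -
      have "P (k - 1 + 1) = f (k - 1 + 1) ** P (k - 1) ** transpose (f (k - 1 + 1))"
        using R unfolding DLP_def by blast
      then show ?thesis
        using that by (simp add: P f)
    qed
    have M: "M k = transpose (\<omega> k) ** \<Lambda> - \<Lambda> ** \<omega> k" if "k \<ge> 1" for k
      using that
    proof (induction k rule: nat_induct_at_least)
      case base
      show ?case using R by (simp add: P f)
    next
      case (Suc k)
      then show ?case
        using step[of k] conjugate_body_momentum[OF SO[of k]] dep[of k] by simp
    qed
    show "moser_veselov \<Lambda> \<omega> M"
      using SO M step by (simp add: moser_veselov_def SO_inverse(2))
  }
qed

end
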